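(* Let $\mathcal{H}$ be a real Hilbert space. A functional $J:\mathcal{H}\to\mathbb{R}\cup\{+\infty\}$ belongs to the class $\mathcal{C}$ if and only if there is a set $K\subset\mathcal{H}$ with $K=-K$ such that $$J(u)=\sup_{p\in K}\langle p,u\rangle=\chi_K^*(u)\quad\text{for all }u\in\mathcal{H}.$$ In this case, it holds $$\partial J(0)=\overline{\mathrm{conv}}(K),$$ where $\overline{\mathrm{conv}}(K)$ denotes the closed convex hull of $K$.
   Context: The class $\mathcal{C}$ consists of all maps $J:\mathcal{H}\to\mathbb{R}\cup\{+\infty\}$ that are convex, lower semicontinuous with respect to the strong topology of $\mathcal{H}$, and absolutely one-homogeneous, i.e. $J(cu)=|c|J(u)$ for all $u\in\mathcal{H}$, $c\in\mathbb{R}\setminus\{0\}$, and $J(0)=0$. The subdifferential at zero is $\partial J(0)=\{p\in\mathcal{H}:\langle p,v\rangle\le J(v)\ \forall v\in\mathcal{H}\}$. The indicator function of $K$ is $\chi_K(u)=0$ if $u\in K$ and $+\infty$ otherwise, and the Fenchel conjugate of $\Phi$ is $\Phi^*(u)=\sup_{v\in\mathcal{H}}\langle v,u\rangle-\Phi(v)$. *)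

theory Defs
  imports "HOL-Analysis.Analysis"
begin

text \<open>A real Hilbert space is a type of sort \<open>{real_inner, complete_space}\<close>. Functionals with
  values in \<open>\<real> \<union> {+\<infinity>}\<close> are functions into \<^typ>\<open>ereal\<close> that avoid \<open>-\<infinity>\<close>.\<close>

definition proper_valued :: "('a \<Rightarrow> ereal) \<Rightarrow> bool" where
  "proper_valued J \<longleftrightarrow> (\<forall>u. J u \<noteq> -\<infinity>)"

text \<open>At the endpoints \<open>t = 0\<close> and \<open>t = 1\<close> the convention \<open>0 * \<infinity> = 0\<close> of
  \<^typ>\<open>ereal\<close> makes the inequality trivial, and no sum \<open>\<infinity> + (-\<infinity>)\<close> occurs for functionals
  that avoid \<open>-\<infinity>\<close>.\<close>

definition convex_functional :: "('a::real_vector \<Rightarrow> ereal) \<Rightarrow> bool" where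
  "convex_functional J \<longleftrightarrow>
    (\<forall>u v. \<forall>t\<in>{0..1}. J ((1 - t) *\<^sub>R u + t *\<^sub>R v) \<le> ereal (1 - t) * J u + ereal t * J v)"

definition lower_semicontinuous :: "('a::topological_space \<Rightarrow> ereal) \<Rightarrow> bool" where
  "lower_semicontinuous J \<longleftrightarrow> (\<forall>u. J u \<le> Liminf (at u) J)"

definition absolutely_one_homogeneous :: "('a::real_vector \<Rightarrow> ereal) \<Rightarrow> bool" where
  "absolutely_one_homogeneous J \<longleftrightarrow>
    (\<forall>u c. c \<noteq> 0 \<longrightarrow> J (c *\<^sub>R u) = ereal \<bar>c\<bar> * J u) \<and> J 0 = 0"

definition class_C :: "('a::{real_inner, complete_space} \<Rightarrow> ereal) set" where
  "class_C = {J. proper_valued J \<and> convex_functional J \<and> lower_semicontinuous J \<and>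
    absolutely_one_homogeneous J}"

definition subdifferential_at_zero :: "('a::real_inner \<Rightarrow> ereal) \<Rightarrow> 'a set" where
  "subdifferential_at_zero J = {p. \<forall>v. ereal (p \<bullet> v) \<le> J v}"

definition indicator_functional :: "'a set \<Rightarrow> 'a \<Rightarrow> ereal" where
  "indicator_functional K u = (if u \<in> K then 0 else \<infinity>)"

definition fenchel_conjugate :: "('a::real_inner \<Rightarrow> ereal) \<Rightarrow> 'a \<Rightarrow> ereal" where
  "fenchel_conjugate \<Phi> u = (SUP v. ereal (v \<bullet> u) - \<Phi> v)"

text \<open>The supremum over \<open>K = {}\<close> is \<open>-\<infinity>\<close>, so a representation of a functional that avoids
  \<open>-\<infinity>\<close> forces \<open>K\<close> to be nonempty.\<close>

definition represented_by ::
    "('a::real_inner \<Rightarrow> ereal) \<Rightarrow> 'a set \<Rightarrow> bool" where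
  "represented_by J K \<longleftrightarrow> K = uminus ` K \<and>
    (\<forall>u. J u = (SUP p\<in>K. ereal (p \<bullet> u)) \<and>
         (SUP p\<in>K. ereal (p \<bullet> u)) = fenchel_conjugate (indicator_functional K) u)"

end

theory Submission
  imports Defs
begin

text \<open>A functional of class \<open>C\<close> is the gauge of its unit sublevel set \<open>{u. J u \<le> 1}\<close>, which is
  closed and convex and contains the origin. If \<open>J u > r > 0\<close>, then \<open>u / r\<close> lies outside this set,
  and a hyperplane that separates the two, normalised to level one, has a normal \<open>p\<close> with
  \<open>p \<bullet> v \<le> 1\<close> on the sublevel set and \<open>p \<bullet> u > r\<close>. Homogeneity turns the first bound into
  \<open>p \<in> \<partial>J(0)\<close>. So \<open>J\<close> is the supremum of the linear functionals in the symmetric set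
  \<open>\<partial>J(0)\<close> (\<open>class_C_eq_support_function\<close>). Using the gauge instead of the epigraph avoids vertical
  hyperplanes, and with them a case distinction on the effective domain of \<open>J\<close>.

  Conversely, a supremum over a nonempty set of continuous linear functionals avoids \<open>-\<infinity>\<close>
  and is convex, lower semicontinuous and
  positively homogeneous, and the symmetry of the index set makes it even
  (\<open>support_function_in_class_C\<close>). The set of all \<open>p\<close> whose linear functional lies below the support
  function of \<open>K\<close> is a closed convex set containing \<open>K\<close>; a point outside
  the closed convex hull of \<open>K\<close> is separated from it by some \<open>u\<close>, and that \<open>u\<close> violates the
  inequality (\<open>subdifferential_support_function\<close>).

  Both separations are instances of the strict separation of a point from a closed convex set in a
  Hilbert space, which follows from the existence of a nearest point
  (\<open>closed_convex_nearest_point_exists\<close>).\<close>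


section \<open>Nearest points and separation in Hilbert spaces\<close>

lemma parallelogram_identity:
  fixes a b :: "'a::real_inner"
  shows "(norm (a - b))\<^sup>2 = 2 * (norm a)\<^sup>2 + 2 * (norm b)\<^sup>2 - (norm (a + b))\<^sup>2"
  by (simp add: power2_norm_eq_inner inner_add inner_diff inner_commute)

text \<open>The points of a convex set that are almost nearest to \<open>z\<close> lie close together, because their
  midpoint stays in the set and so cannot be much nearer to \<open>z\<close> than they are; the parallelogram
  law makes this quantitative.\<close>

lemma almost_nearest_points_close:
  fixes S :: "'a::real_inner set"
  assumes "convex S" and x: "x \<in> S" "dist z x \<le> d + e" and y: "y \<in> S" "dist z y \<le> d + e"
    and d: "\<And>w. w \<in> S \<Longrightarrow> d \<le> dist z w" and "0 \<le> d"
  shows "(dist x y)\<^sup>2 \<le> 4 * ((d + e)\<^sup>2 - d\<^sup>2)"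
proof -
  let ?m = "(1/2) *\<^sub>R x + (1/2) *\<^sub>R y"
  have "?m \<in> S"
    using \<open>convex S\<close> x(1) y(1) by (intro convexD) auto
  then have "d\<^sup>2 \<le> (dist z ?m)\<^sup>2"
    using d \<open>0 \<le> d\<close> by (intro power_mono)
  moreover have "(dist z x)\<^sup>2 \<le> (d + e)\<^sup>2" "(dist z y)\<^sup>2 \<le> (d + e)\<^sup>2"
    using x(2) y(2) by (auto intro!: power_mono)
  moreover have "(dist x y)\<^sup>2 = 2 * (dist z x)\<^sup>2 + 2 * (dist z y)\<^sup>2 - 4 * (dist z ?m)\<^sup>2"
  proof -
    have diff: "x - y = (z - y) - (z - x)"
      by simp
    have "z - ?m = (1/2) *\<^sub>R ((z - y) + (z - x))"
      by (simp add: scaleR_diff_right scaleR_add_right flip: scaleR_2)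
    then have mid: "(norm (z - ?m))\<^sup>2 = (norm ((z - y) + (z - x)))\<^sup>2 / 4"
      by (simp add: power_divide)
    show ?thesis
      unfolding dist_norm mid unfolding diff parallelogram_identity by simp
  qed
  ultimately show ?thesis by simp
qed

text \<open>Completeness replaces compactness: the almost-nearest points form a nested sequence of
  closed sets whose diameters tend to zero.\<close>

lemma closed_convex_nearest_point_exists:
  fixes S :: "'a::{real_inner, complete_space} set"
  assumes "closed S" "convex S" "S \<noteq> {}"
  obtains y where "y \<in> S" "\<And>x. x \<in> S \<Longrightarrow> dist z y \<le> dist z x"
proof -
  define d where "d = infdist z S"
  define e where "e n = 1 / real (Suc n)" for n
  define T where "T n = S \<inter> cball z (d + e n)" for n
  have d: "d \<le> dist z w" if "w \<in> S" for w
    using that by (simp add: d_def infdist_le)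
  have "0 \<le> d"
    by (simp add: d_def infdist_nonneg)
  have e_pos: "0 < e n" for n
    by (simp add: e_def)
  have e_lim: "e \<longlonglongrightarrow> 0"
    unfolding e_def by (rule LIMSEQ_Suc[OF lim_1_over_n])
  obtain y where y: "\<And>n. y \<in> T n"
  proof (rule decreasing_closed_nest[of T])
    show "closed (T n)" for n
      using \<open>closed S\<close> by (auto simp: T_def)
    show "T n \<noteq> {}" for n
    proof -
      have "(INF w\<in>S. dist z w) < d + e n"
        using e_pos[of n] \<open>S \<noteq> {}\<close> by (simp add: d_def infdist_def)
      then obtain w where "w \<in> S" "dist z w < d + e n"
        using cInf_lessD[of "dist z ` S"] \<open>S \<noteq> {}\<close> by auto
      then show ?thesis
        by (auto simp: T_def)
    qed
    show "T n \<subseteq> T m" if "m \<le> n" for m n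
    proof -
      have "e n \<le> e m"
        using that by (simp add: e_def frac_le)
      then show ?thesis
        by (auto simp: T_def)
    qed
    show "\<exists>n. \<forall>x\<in>T n. \<forall>y\<in>T n. dist x y < \<epsilon>" if "\<epsilon> > 0" for \<epsilon>
    proof -
      have "(\<lambda>n. 4 * ((d + e n)\<^sup>2 - d\<^sup>2)) \<longlonglongrightarrow> 4 * ((d + 0)\<^sup>2 - d\<^sup>2)"
        by (intro tendsto_intros e_lim)
      then have "\<forall>\<^sub>F n in sequentially. 4 * ((d + e n)\<^sup>2 - d\<^sup>2) < \<epsilon>\<^sup>2"
        using that by (intro order_tendstoD(2)) auto
      then obtain n where n: "4 * ((d + e n)\<^sup>2 - d\<^sup>2) < \<epsilon>\<^sup>2"
        by (auto simp: eventually_sequentially)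
      have "dist x y < \<epsilon>" if "x \<in> T n" "y \<in> T n" for x y
      proof -
        have "(dist x y)\<^sup>2 \<le> 4 * ((d + e n)\<^sup>2 - d\<^sup>2)"
          using that \<open>convex S\<close> d \<open>0 \<le> d\<close>
          by (intro almost_nearest_points_close[of S]) (auto simp: T_def)
        then show ?thesis
          using n \<open>\<epsilon> > 0\<close> by (intro power2_less_imp_less[of "dist x y" \<epsilon>]) auto
      qed
      then show ?thesis by blast
    qed
  qed blast
  have "dist z y \<le> d + 0"
    using y by (intro tendsto_lowerbound[OF tendsto_add[OF tendsto_const e_lim]])
      (auto simp: T_def)
  then show ?thesis
    using that[of y] y[of 0] d by (force simp: T_def)
qed

text \<open>The normal of the separating hyperplane is the displacement from the nearest point to \<open>z\<close>.\<close>

lemma closed_convex_point_separation: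
  fixes S :: "'a::{real_inner, complete_space} set"
  assumes "closed S" "convex S" "S \<noteq> {}" "z \<notin> S"
  obtains a b where "\<And>x. x \<in> S \<Longrightarrow> a \<bullet> x < b" "b < a \<bullet> z"
proof -
  obtain y where y: "y \<in> S" "\<And>x. x \<in> S \<Longrightarrow> dist z y \<le> dist z x"
    using closed_convex_nearest_point_exists[OF assms(1-3)] by metis
  have le: "(z - y) \<bullet> x \<le> (z - y) \<bullet> y" if "x \<in> S" for x
    using any_closest_point_dot[of S y x z] assms that y by (auto simp: inner_diff_right)
  have "(z - y) \<bullet> (z - y) > 0"
    using y(1) \<open>z \<notin> S\<close> by auto
  then have lt: "(z - y) \<bullet> y < (z - y) \<bullet> z"
    by (simp add: inner_diff_right)
  then obtain b where "(z - y) \<bullet> y < b" "b < (z - y) \<bullet> z"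
    using dense by blast
  then show ?thesis
    using that[of "z - y" b] le by force
qed


section \<open>Support functions\<close>

definition support_function :: "'a::real_inner set \<Rightarrow> 'a \<Rightarrow> ereal" where
  "support_function K u = (SUP p\<in>K. ereal (p \<bullet> u))"

lemma support_function_upper: "p \<in> K \<Longrightarrow> ereal (p \<bullet> u) \<le> support_function K u"
  unfolding support_function_def by (rule SUP_upper)

lemma support_function_least:
  "(\<And>p. p \<in> K \<Longrightarrow> ereal (p \<bullet> u) \<le> c) \<Longrightarrow> support_function K u \<le> c"
  unfolding support_function_def by (rule SUP_least)

text \<open>The indicator removes the points outside \<open>K\<close> from the supremum by giving them the value
  \<open>-\<infinity>\<close>; this also covers \<open>K = {}\<close>.\<close>

lemma fenchel_conjugate_indicator:
  "fenchel_conjugate (indicator_functional K) = support_function K"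
proof (intro ext antisym)
  fix u
  show "fenchel_conjugate (indicator_functional K) u \<le> support_function K u"
    unfolding fenchel_conjugate_def
    by (intro SUP_least) (auto simp: indicator_functional_def support_function_upper)
  show "support_function K u \<le> fenchel_conjugate (indicator_functional K) u"
    unfolding fenchel_conjugate_def
    by (intro support_function_least SUP_upper2) (auto simp: indicator_functional_def)
qed

lemma represented_by_iff_support_function:
  "represented_by J K \<longleftrightarrow> K = uminus ` K \<and> J = support_function K"
  unfolding represented_by_def fenchel_conjugate_indicator
  by (auto simp: support_function_def)

lemma convex_functional_support_function: "convex_functional (support_function K)"
  unfolding convex_functional_def
proof (intro allI ballI support_function_least)
  fix u v p and t :: real
  assume t: "t \<in> {0..1}" and p: "p \<in> K"
  have "ereal (p \<bullet> ((1 - t) *\<^sub>R u + t *\<^sub>R v)) = ereal (1 - t) * ereal (p \<bullet> u) + ereal t * ereal (p \<bullet> v)"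
    by (simp add: inner_add_right)
  also have "\<dots> \<le> ereal (1 - t) * support_function K u + ereal t * support_function K v"
    using t p by (intro add_mono ereal_mult_left_mono support_function_upper) auto
  finally show "ereal (p \<bullet> ((1 - t) *\<^sub>R u + t *\<^sub>R v))
      \<le> ereal (1 - t) * support_function K u + ereal t * support_function K v" .
qed

lemma lower_semicontinuous_support_function: "lower_semicontinuous (support_function K)"
  unfolding lower_semicontinuous_def le_Liminf_iff
proof (intro allI impI)
  fix u y
  assume "y < support_function K u"
  then obtain p where p: "p \<in> K" "y < ereal (p \<bullet> u)"
    by (auto simp: support_function_def less_SUP_iff)
  have "((\<lambda>x. ereal (p \<bullet> x)) \<longlongrightarrow> ereal (p \<bullet> u)) (at u)"
    by (intro tendsto_intros)
  then have "\<forall>\<^sub>F x in at u. y < ereal (p \<bullet> x)"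
    using p(2) by (rule order_tendstoD)
  then show "\<forall>\<^sub>F x in at u. y < support_function K x"
    by eventually_elim (use p(1) support_function_upper less_le_trans in blast)
qed

text \<open>The factor \<open>sgn c\<close> is absorbed by the symmetric index set. This gives one inequality; the
  other one is the same inequality for the scalar \<open>1 / c\<close>.\<close>

lemma absolutely_one_homogeneous_support_function:
  assumes sym: "K = uminus ` K" and "K \<noteq> {}"
  shows "absolutely_one_homogeneous (support_function K)"
proof -
  have le: "support_function K (c *\<^sub>R u) \<le> ereal \<bar>c\<bar> * support_function K u" for c u
  proof (rule support_function_least)
    fix p assume p: "p \<in> K"
    then have "- p \<in> K"
      using sym by blast
    with p obtain q where q: "q \<in> K" "p \<bullet> (c *\<^sub>R u) = \<bar>c\<bar> * (q \<bullet> u)"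
      by (cases "c \<ge> 0") (force, force)
    then have "ereal (p \<bullet> (c *\<^sub>R u)) = ereal \<bar>c\<bar> * ereal (q \<bullet> u)"
      by simp
    also have "\<dots> \<le> ereal \<bar>c\<bar> * support_function K u"
      using q(1) by (intro ereal_mult_left_mono support_function_upper) auto
    finally show "ereal (p \<bullet> (c *\<^sub>R u)) \<le> ereal \<bar>c\<bar> * support_function K u" .
  qed
  have ge: "ereal \<bar>c\<bar> * support_function K u \<le> support_function K (c *\<^sub>R u)" if "c \<noteq> 0" for c u
  proof -
    have "support_function K u \<le> ereal \<bar>1 / c\<bar> * support_function K (c *\<^sub>R u)"
      using le[of "1 / c" "c *\<^sub>R u"] that by simp
    then have "ereal \<bar>c\<bar> * support_function K u
        \<le> ereal \<bar>c\<bar> * (ereal \<bar>1 / c\<bar> * support_function K (c *\<^sub>R u))"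
      by (intro ereal_mult_left_mono) auto
    also have "\<dots> = ereal (\<bar>c\<bar> * \<bar>1 / c\<bar>) * support_function K (c *\<^sub>R u)"
      by (simp only: mult.assoc[symmetric] times_ereal.simps)
    also have "\<dots> = support_function K (c *\<^sub>R u)"
      using that by (simp add: one_ereal_def[symmetric])
    finally show ?thesis .
  qed
  have "support_function K 0 = 0"
    using \<open>K \<noteq> {}\<close> by (simp add: support_function_def zero_ereal_def)
  with le ge show ?thesis
    unfolding absolutely_one_homogeneous_def by (auto intro: antisym)
qed

lemma support_function_in_class_C:
  fixes K :: "'a::{real_inner, complete_space} set"
  assumes "K = uminus ` K" "K \<noteq> {}"
  shows "support_function K \<in> class_C"
proof -
  have "proper_valued (support_function K)"
    unfolding proper_valued_def
  proof
    fix u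
    obtain p where "p \<in> K"
      using \<open>K \<noteq> {}\<close> by blast
    then show "support_function K u \<noteq> -\<infinity>"
      using support_function_upper[of p K u] by auto
  qed
  then show ?thesis
    using assms by (simp add: class_C_def convex_functional_support_function
        lower_semicontinuous_support_function absolutely_one_homogeneous_support_function)
qed


section \<open>The subdifferential at zero\<close>

lemma closed_convex_subdifferential_at_zero:
  "closed (subdifferential_at_zero J)" "convex (subdifferential_at_zero J)"
proof -
  have eq: "subdifferential_at_zero J = (\<Inter>v. {p. ereal (p \<bullet> v) \<le> J v})"
    by (auto simp: subdifferential_at_zero_def)
  have "closed {p. ereal (p \<bullet> v) \<le> J v} \<and> convex {p. ereal (p \<bullet> v) \<le> J v}" for v
  proof (cases "J v")
    case (real r)
    then have "{p. ereal (p \<bullet> v) \<le> J v} = {p. v \<bullet> p \<le> r}"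
      by (auto simp: inner_commute)
    then show ?thesis
      by (simp add: closed_halfspace_le convex_halfspace_le)
  qed auto
  then show "closed (subdifferential_at_zero J)" "convex (subdifferential_at_zero J)"
    unfolding eq by (auto intro!: convex_INT)
qed

theorem subdifferential_support_function:
  fixes K :: "'a::{real_inner, complete_space} set"
  assumes "K \<noteq> {}"
  shows "subdifferential_at_zero (support_function K) = closure (convex hull K)"
proof (rule antisym)
  have "K \<subseteq> subdifferential_at_zero (support_function K)"
    by (auto simp: subdifferential_at_zero_def support_function_upper)
  then show "closure (convex hull K) \<subseteq> subdifferential_at_zero (support_function K)"
    by (intro closure_minimal hull_minimal closed_convex_subdifferential_at_zero)
  show "subdifferential_at_zero (support_function K) \<subseteq> closure (convex hull K)"
  proof (rule subsetI, rule ccontr)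
    fix p
    assume p: "p \<in> subdifferential_at_zero (support_function K)" "p \<notin> closure (convex hull K)"
    have "closure (convex hull K) \<noteq> {}"
      using assms by simp
    then obtain u b where ub: "\<And>k. k \<in> closure (convex hull K) \<Longrightarrow> u \<bullet> k < b" "b < u \<bullet> p"
      using closed_convex_point_separation[OF closed_closure convex_closure[OF convex_convex_hull] _ p(2)]
      by metis
    have "k \<in> closure (convex hull K)" if "k \<in> K" for k
      using that closure_subset hull_inc by (metis subsetD)
    then have "support_function K u \<le> ereal b"
      using ub(1) by (intro support_function_least) (force simp: inner_commute)
    moreover have "ereal (p \<bullet> u) \<le> support_function K u"
      using p(1) by (simp add: subdifferential_at_zero_def)
    ultimately have "ereal (p \<bullet> u) \<le> ereal b"
      by (rule order_trans[rotated])
    with ub(2) show False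
      by (simp add: inner_commute)
  qed
qed


section \<open>Functionals of class C as support functions\<close>

lemma lower_semicontinuous_closed_sublevel:
  assumes "lower_semicontinuous J"
  shows "closed {u. J u \<le> c}"
proof -
  have "\<forall>\<^sub>F x in nhds u. c < J x" if "c < J u" for u
  proof -
    have "\<forall>\<^sub>F x in at u. c < J x"
      using assms that by (auto simp: lower_semicontinuous_def le_Liminf_iff)
    then show ?thesis
      using that by (auto simp: eventually_at_filter elim: eventually_mono)
  qed
  then have "open {u. c < J u}"
    by (subst open_subopen) (force simp: eventually_nhds)
  moreover have "{u. J u \<le> c} = - {u. c < J u}"
    by auto
  ultimately show ?thesis
    by (simp add: open_closed)
qed

lemma convex_functional_convex_sublevel:
  assumes "convex_functional J"
  shows "convex {u. J u \<le> ereal c}"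
proof (rule convexI, unfold mem_Collect_eq)
  fix u v and s t :: real
  assume uv: "J u \<le> ereal c" "J v \<le> ereal c" and st: "0 \<le> s" "0 \<le> t" "s + t = 1"
  then have s: "s = 1 - t"
    by simp
  have "J (s *\<^sub>R u + t *\<^sub>R v) \<le> ereal s * J u + ereal t * J v"
    using assms st unfolding convex_functional_def s by auto
  also have "\<dots> \<le> ereal s * ereal c + ereal t * ereal c"
    using uv st by (intro add_mono ereal_mult_left_mono) auto
  also have "\<dots> = ereal c"
    using st by (simp add: distrib_right[symmetric])
  finally show "J (s *\<^sub>R u + t *\<^sub>R v) \<le> ereal c" .
qed

lemma absolutely_one_homogeneousD:
  assumes "absolutely_one_homogeneous J" "c \<noteq> 0"
  shows "J (c *\<^sub>R u) = ereal \<bar>c\<bar> * J u"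
  using assms unfolding absolutely_one_homogeneous_def by simp

lemma absolutely_one_homogeneous_even:
  assumes "absolutely_one_homogeneous J"
  shows "J (- u) = J u"
  using absolutely_one_homogeneousD[OF assms, of "-1" u]
  by (simp add: one_ereal_def[symmetric])

text \<open>The origin is the midpoint of \<open>u\<close> and \<open>- u\<close>, at which an even functional takes the same
  value.\<close>

lemma class_C_nonneg:
  assumes "J \<in> class_C"
  shows "0 \<le> J u"
proof -
  have conv: "convex_functional J" and hom: "absolutely_one_homogeneous J"
    using assms by (auto simp: class_C_def)
  have "J ((1 - 1/2) *\<^sub>R u + (1/2) *\<^sub>R (- u)) \<le> ereal (1 - 1/2) * J u + ereal (1/2) * J (- u)"
    by (rule conv[unfolded convex_functional_def, rule_format]) simp
  moreover have "J ((1 - 1/2) *\<^sub>R u + (1/2) *\<^sub>R (- u)) = 0"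
    using hom by (simp add: absolutely_one_homogeneous_def)
  ultimately show ?thesis
    by (cases "J u") (auto simp: absolutely_one_homogeneous_even[OF hom])
qed

lemma subdifferential_at_zero_symmetric:
  assumes "J \<in> class_C"
  shows "subdifferential_at_zero J = uminus ` subdifferential_at_zero J"
proof -
  have even: "J (- v) = J v" for v
    using assms by (intro absolutely_one_homogeneous_even) (simp add: class_C_def)
  have neg: "- p \<in> subdifferential_at_zero J" if "p \<in> subdifferential_at_zero J" for p
    unfolding subdifferential_at_zero_def
  proof (intro CollectI allI)
    fix v
    have "ereal (p \<bullet> (- v)) \<le> J (- v)"
      using that unfolding subdifferential_at_zero_def by blast
    then show "ereal (- p \<bullet> v) \<le> J v"
      by (simp add: even)
  qed
  show ?thesis
    using neg by (force simp: image_iff)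
qed

text \<open>A linear functional bounded by one on the unit sublevel set is bounded by \<open>J\<close> everywhere,
  since \<open>v / t\<close> lies in that set for every positive real \<open>t \<ge> J v\<close>.\<close>

lemma subdifferential_at_zero_from_sublevel:
  assumes "J \<in> class_C" and p: "\<And>v. J v \<le> 1 \<Longrightarrow> p \<bullet> v \<le> 1"
  shows "p \<in> subdifferential_at_zero J"
  unfolding subdifferential_at_zero_def
proof (intro CollectI allI)
  fix v
  show "ereal (p \<bullet> v) \<le> J v"
  proof (rule dense_ge)
    fix y assume y: "J v < y"
    show "ereal (p \<bullet> v) \<le> y"
    proof (cases y)
      case (real t)
      have "0 < t"
        using class_C_nonneg[OF assms(1), of v] y real by (metis ereal_less(2) le_less_trans)
      have "J ((1 / t) *\<^sub>R v) = ereal \<bar>1 / t\<bar> * J v"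
        using assms(1) \<open>0 < t\<close> by (intro absolutely_one_homogeneousD) (auto simp: class_C_def)
      also have "\<dots> \<le> ereal \<bar>1 / t\<bar> * ereal t"
        using y real by (intro ereal_mult_left_mono) auto
      also have "\<dots> = 1"
        using \<open>0 < t\<close> by (simp add: one_ereal_def)
      finally have "p \<bullet> ((1 / t) *\<^sub>R v) \<le> 1"
        by (rule p)
      then show ?thesis
        using \<open>0 < t\<close> real by (simp add: field_simps)
    qed (use y in auto)
  qed
qed

theorem class_C_eq_support_function:
  assumes "J \<in> class_C"
  shows "J = support_function (subdifferential_at_zero J)"
proof (intro ext antisym)
  have hom: "absolutely_one_homogeneous J"
    using assms by (simp add: class_C_def)
  fix u
  let ?S = "{v. J v \<le> ereal 1}"
  show "support_function (subdifferential_at_zero J) u \<le> J u"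
    by (intro support_function_least) (simp add: subdifferential_at_zero_def)
  show "J u \<le> support_function (subdifferential_at_zero J) u"
  proof (rule dense_le)
    fix y assume y: "y < J u"
    have "J 0 = 0"
      using hom by (simp only: absolutely_one_homogeneous_def)
    then have S: "closed ?S" "convex ?S" "0 \<in> ?S"
      using assms by (simp_all add: class_C_def lower_semicontinuous_closed_sublevel
          convex_functional_convex_sublevel)
    have "0 \<in> subdifferential_at_zero J"
      using class_C_nonneg[OF assms] by (simp add: subdifferential_at_zero_def zero_ereal_def[symmetric])
    then have nonneg: "0 \<le> support_function (subdifferential_at_zero J) u"
      using support_function_upper[of 0 _ u] by (simp add: zero_ereal_def[symmetric])
    show "y \<le> support_function (subdifferential_at_zero J) u"
    proof (cases "y \<le> 0")
      case True
      then show ?thesis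
        using nonneg by simp
    next
      case False
      moreover from y have "y \<noteq> \<infinity>"
        by auto
      ultimately obtain r where r: "y = ereal r" "0 < r"
        by (cases y) auto
      have "(1 / r) *\<^sub>R u \<notin> ?S"
      proof
        assume "(1 / r) *\<^sub>R u \<in> ?S"
        moreover have "J u = ereal \<bar>r\<bar> * J ((1 / r) *\<^sub>R u)"
          using absolutely_one_homogeneousD[OF hom, of r "(1 / r) *\<^sub>R u"] r(2) by simp
        ultimately have "J u \<le> ereal \<bar>r\<bar> * ereal 1"
          by (simp only: mem_Collect_eq) (intro ereal_mult_left_mono, auto)
        then show False
          using y r by simp
      qed
      then obtain a b where ab: "\<And>x. x \<in> ?S \<Longrightarrow> a \<bullet> x < b" "b < a \<bullet> ((1 / r) *\<^sub>R u)"
        using closed_convex_point_separation[OF S(1,2)] S(3) by blast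
      \<comment> \<open>As the origin lies in the sublevel set, the separating level is positive, and dividing
        by it normalises the hyperplane to level one.\<close>
      have "0 < b"
        using ab(1)[OF S(3)] by simp
      define p where "p = (1 / b) *\<^sub>R a"
      have "p \<in> subdifferential_at_zero J"
      proof (rule subdifferential_at_zero_from_sublevel[OF assms])
        fix v assume "J v \<le> 1"
        then have "a \<bullet> v < b"
          by (intro ab(1)) (simp add: one_ereal_def)
        then show "p \<bullet> v \<le> 1"
          using \<open>0 < b\<close> by (simp add: p_def)
      qed
      moreover have "r \<le> p \<bullet> u"
        using ab(2) \<open>0 < b\<close> r(2) by (simp add: p_def field_simps)
      ultimately show ?thesis
        using support_function_upper[of p _ u] r(1) by (meson ereal_less_eq(3) order_trans)
    qed
  qed
qed


section \<open>The representation theorem\<close>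

theorem theorem2p3:
  fixes J :: "'a::{real_inner, complete_space} \<Rightarrow> ereal"
  assumes "proper_valued J"
  shows "(J \<in> class_C \<longleftrightarrow> (\<exists>K. represented_by J K)) \<and>
    (\<forall>K. represented_by J K \<longrightarrow> subdifferential_at_zero J = closure (convex hull K))"
proof -
  have rep: "J = support_function K" "K = uminus ` K" "K \<noteq> {}" if "represented_by J K" for K
  proof -
    show J: "J = support_function K" and "K = uminus ` K"
      using that unfolding represented_by_iff_support_function by blast+
    show "K \<noteq> {}"
    proof
      assume "K = {}"
      then have "J 0 = -\<infinity>"
        unfolding J by (simp add: support_function_def bot_ereal_def)
      then show False
        using assms by (simp add: proper_valued_def)
    qed
  qed
  have "represented_by J (subdifferential_at_zero J)" if "J \<in> class_C"
    unfolding represented_by_iff_support_function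
    using subdifferential_at_zero_symmetric[OF that] class_C_eq_support_function[OF that]
    by (rule conjI)
  moreover have "J \<in> class_C" if "represented_by J K" for K
    using support_function_in_class_C[OF rep(2,3)[OF that]] by (simp only: rep(1)[OF that])
  moreover have "subdifferential_at_zero J = closure (convex hull K)" if "represented_by J K" for K
    using subdifferential_support_function[OF rep(3)[OF that]] by (simp only: rep(1)[OF that])
  ultimately show ?thesis
    by blast
qed

end
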